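(* Let $\delta\in\mathbb C^\times$ and let $(\mathsf X_\delta,\mathsf Y_\delta)$ be one of the following three pairs of classes of algebras over $\mathbb C$: (a) ($\delta$-Novikov-Poisson algebras, $\delta$-mock-Novikov-Poisson algebras); (b) ($\delta$-Poisson algebras, $\delta$-mock-Poisson algebras); (c) (transposed $\delta$-Poisson algebras, transposed $\delta$-mock-Poisson algebras). For $i=1,2$, let $(\mathcal A_i,\ast_i,\diamond_i)$ be either an $\mathsf X_\delta$-algebra or a $\mathsf Y_\delta$-algebra, and set $\varepsilon_i=1$ if $\mathcal A_i$ is taken as an $\mathsf X_\delta$-algebra and $\varepsilon_i=-1$ if $\mathcal A_i$ is taken as a $\mathsf Y_\delta$-algebra. Here $\diamond_i$ denotes the operation $\circ_i$ in case (a) and the bracket $\{-,-\}_i$ in cases (b) and (c). Define bilinear operations $\ast$ and $\diamond$ on $\mathcal A_1\otimes\mathcal A_2$ by $$(x_1\otimes x_2)\ast(y_1\otimes y_2)=(x_1\ast_1y_1)\otimes(x_2\ast_2y_2),$$ $$(x_1\otimes x_2)\diamond(y_1\otimes y_2)=(x_1\diamond_1y_1)\otimes(x_2\ast_2y_2)+(x_1\ast_1y_1)\otimes(x_2\diamond_2y_2),$$ for $x_i,y_i\in\mathcal A_i$, extended bilinearly. Then $(\mathcal A_1\otimes\mathcal A_2,\ast,\diamond)$ is an $\mathsf X_\delta$-algebra if $\varepsilon_1\varepsilon_2=1$, and a $\mathsf Y_\delta$-algebra if $\varepsilon_1\varepsilon_2=-1$.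
   Context: The ground field is $\mathbb C$. All operations are bilinear, not necessarily associative, and identities are required for all $a,b,c$. "Anti-commutative anti-associative" means $a\ast b=-b\ast a$ and $(a\ast b)\ast c=-a\ast(b\ast c)$. A mock-Lie algebra is a vector space with a symmetric bilinear product $\{-,-\}$ satisfying $\{\{a,b\},c\}+\{\{b,c\},a\}+\{\{c,a\},b\}=0$. $\delta$-Novikov-Poisson algebra $(\mathcal A,\ast,\circ)$: $\ast$ is commutative and associative, and $$(a\circ b)\circ c=(a\circ c)\circ b,\qquad \delta(a\circ b)\circ c-a\circ(b\circ c)=\delta(b\circ a)\circ c-b\circ(a\circ c),$$ $$(a\ast b)\circ c=a\ast(b\circ c),\qquad \delta(a\circ b)\ast c-a\circ(b\ast c)=\delta(b\circ a)\ast c-b\circ(a\ast c).$$ $\delta$-mock-Novikov-Poisson algebra $(\mathcal A,\ast,\circ)$: $\ast$ is anti-commutative and anti-associative, and $$(a\circ b)\circ c+(a\circ c)\circ b=0,\qquad \delta(a\circ b)\circ c+\delta(b\circ a)\circ c+a\circ(b\circ c)+b\circ(a\circ c)=0,$$ $$(a\ast b)\circ c+a\ast(b\circ c)=0,\qquad \delta(a\circ b)\ast c+\delta(b\circ a)\ast c+a\circ(b\ast c)+b\circ(a\ast c)=0.$$ $\delta$-Poisson algebra $(\mathcal A,\ast,\{-,-\})$: $\ast$ is commutative and associative, $\{-,-\}$ is a Lie bracket, and $\{a\ast b,c\}=\delta(a\ast\{b,c\}+\{a,c\}\ast b)$. $\delta$-mock-Poisson algebra $(\mathcal A,\ast,\{-,-\})$: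 $\ast$ is anti-commutative and anti-associative, $(\mathcal A,\{-,-\})$ is mock-Lie, and $\{a\ast b,c\}=-\delta(a\ast\{b,c\}+\{a,c\}\ast b)$. Transposed $\delta$-Poisson algebra $(\mathcal A,\ast,\{-,-\})$: $\ast$ is commutative and associative, $\{-,-\}$ is a Lie bracket, and $2\delta\,a\ast\{b,c\}=\{a\ast b,c\}+\{b,a\ast c\}$. Transposed $\delta$-mock-Poisson algebra $(\mathcal A,\ast,\{-,-\})$: $\ast$ is anti-commutative and anti-associative, $(\mathcal A,\{-,-\})$ is mock-Lie, and $-2\delta\,a\ast\{b,c\}=\{a\ast b,c\}+\{b,a\ast c\}$. *)

theory Defs
  imports Complex_Main "HOL-Library.Poly_Mapping"
begin

section \<open>Vector spaces over the complex numbers\<close>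

class complex_vector = ab_group_add +
  fixes scaleC :: "complex \<Rightarrow> 'a \<Rightarrow> 'a" (infixr "*\<^sub>C" 75)
  assumes scaleC_add_right: "c *\<^sub>C (x + y) = c *\<^sub>C x + c *\<^sub>C y"
    and scaleC_add_left: "(c + d) *\<^sub>C x = c *\<^sub>C x + d *\<^sub>C x"
    and scaleC_scaleC: "c *\<^sub>C (d *\<^sub>C x) = (c * d) *\<^sub>C x"
    and scaleC_one: "1 *\<^sub>C x = x"

global_interpretation complex_vector: vector_space "scaleC :: complex \<Rightarrow> 'a \<Rightarrow> 'a::complex_vector"
  by unfold_locales (simp_all add: scaleC_add_right scaleC_add_left scaleC_scaleC scaleC_one)

abbreviation clinear :: "('a::complex_vector \<Rightarrow> 'b::complex_vector) \<Rightarrow> bool" where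
  "clinear \<equiv> Vector_Spaces.linear scaleC scaleC"

definition cbilinear ::
  "('a::complex_vector \<Rightarrow> 'b::complex_vector \<Rightarrow> 'c::complex_vector) \<Rightarrow> bool" where
  "cbilinear f \<longleftrightarrow> (\<forall>x. clinear (f x)) \<and> (\<forall>y. clinear (\<lambda>x. f x y))"

lemma clinear_iff:
  "clinear f \<longleftrightarrow> (\<forall>x y. f (x + y) = f x + f y) \<and> (\<forall>c x. f (c *\<^sub>C x) = c *\<^sub>C f x)"
  by (simp add: Vector_Spaces.linear_iff complex_vector.vector_space_axioms)

lemma clinear_add: "clinear f \<Longrightarrow> f (x + y) = f x + f y"
  and clinear_scale: "clinear f \<Longrightarrow> f (c *\<^sub>C x) = c *\<^sub>C f x"
  by (auto simp: clinear_iff)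

lemma clinear_0: "clinear f \<Longrightarrow> f 0 = 0"
  using clinear_add[of f 0 0] by simp

lemma clinear_diff: "clinear f \<Longrightarrow> f (x - y) = f x - f y"
  using clinear_add[of f "x - y" y] by simp

section \<open>The tensor product\<close>

text \<open>
  The free vector space on a type \<open>'k\<close> is the type \<open>'k \<Rightarrow>\<^sub>0 complex\<close> of finitely supported
  functions.  The tensor product is the quotient of the free vector space on \<open>'a \<times> 'b\<close> by the
  subspace that the usual bilinearity relations span.
\<close>

instantiation poly_mapping :: (type, complex_vector) complex_vector
begin

lift_definition scaleC_poly_mapping ::
  "complex \<Rightarrow> ('a \<Rightarrow>\<^sub>0 'b) \<Rightarrow> 'a \<Rightarrow>\<^sub>0 'b" is "\<lambda>c f k. c *\<^sub>C f k"
  by (erule finite_subset[rotated]) auto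

instance
  by standard
    (transfer; simp add: fun_eq_iff scaleC_add_right scaleC_add_left scaleC_scaleC scaleC_one)+

end

instantiation complex :: complex_vector
begin

definition scaleC_complex :: "complex \<Rightarrow> complex \<Rightarrow> complex" where
  "scaleC_complex = (*)"

instance
  by standard (simp_all add: scaleC_complex_def algebra_simps)

end

abbreviation free_gen :: "'k \<Rightarrow> 'k \<Rightarrow>\<^sub>0 complex" where
  "free_gen k \<equiv> Poly_Mapping.single k 1"

definition tensor_relators :: "('a::complex_vector \<times> 'b::complex_vector \<Rightarrow>\<^sub>0 complex) set" where
  "tensor_relators =
     {free_gen (x + x', y) - free_gen (x, y) - free_gen (x', y) | x x' y. True} \<union>
     {free_gen (x, y + y') - free_gen (x, y) - free_gen (x, y') | x y y'. True} \<union>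
     {free_gen (c *\<^sub>C x, y) - c *\<^sub>C free_gen (x, y) | c x y. True} \<union>
     {free_gen (x, c *\<^sub>C y) - c *\<^sub>C free_gen (x, y) | c x y. True}"

definition tensor_rel ::
  "('a::complex_vector \<times> 'b::complex_vector \<Rightarrow>\<^sub>0 complex) \<Rightarrow> ('a \<times> 'b \<Rightarrow>\<^sub>0 complex) \<Rightarrow> bool" where
  "tensor_rel p q \<longleftrightarrow> p - q \<in> complex_vector.span tensor_relators"

quotient_type (overloaded) ('a, 'b) tensor =
  "'a::complex_vector \<times> 'b::complex_vector \<Rightarrow>\<^sub>0 complex" / tensor_rel
proof (rule equivpI)
  show "reflp (tensor_rel :: ('a \<times> 'b \<Rightarrow>\<^sub>0 complex) \<Rightarrow> _)"
    by (rule reflpI) (simp add: tensor_rel_def complex_vector.span_zero)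
  show "symp (tensor_rel :: ('a \<times> 'b \<Rightarrow>\<^sub>0 complex) \<Rightarrow> _)"
  proof (rule sympI)
    fix p q :: "'a \<times> 'b \<Rightarrow>\<^sub>0 complex"
    assume "tensor_rel p q"
    then show "tensor_rel q p"
      unfolding tensor_rel_def using complex_vector.span_neg by fastforce
  qed
  show "transp (tensor_rel :: ('a \<times> 'b \<Rightarrow>\<^sub>0 complex) \<Rightarrow> _)"
  proof (rule transpI)
    fix p q r :: "'a \<times> 'b \<Rightarrow>\<^sub>0 complex"
    assume "tensor_rel p q" "tensor_rel q r"
    then show "tensor_rel p r"
      unfolding tensor_rel_def using complex_vector.span_add by fastforce
  qed
qed

instantiation tensor :: (complex_vector, complex_vector) complex_vector
begin

lift_definition zero_tensor :: "('a, 'b) tensor" is 0 .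

lift_definition plus_tensor :: "('a, 'b) tensor \<Rightarrow> ('a, 'b) tensor \<Rightarrow> ('a, 'b) tensor" is "(+)"
  unfolding tensor_rel_def by (metis add_diff_add complex_vector.span_add)

lift_definition uminus_tensor :: "('a, 'b) tensor \<Rightarrow> ('a, 'b) tensor" is uminus
  unfolding tensor_rel_def by (metis complex_vector.span_neg minus_diff_minus)

lift_definition minus_tensor :: "('a, 'b) tensor \<Rightarrow> ('a, 'b) tensor \<Rightarrow> ('a, 'b) tensor" is "(-)"
  unfolding tensor_rel_def
proof -
  fix p p' q q' :: "'a \<times> 'b \<Rightarrow>\<^sub>0 complex"
  assume "p - p' \<in> complex_vector.span tensor_relators"
    "q - q' \<in> complex_vector.span tensor_relators"
  then have "(p - p') - (q - q') \<in> complex_vector.span tensor_relators"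
    by (rule complex_vector.span_diff)
  then show "p - q - (p' - q') \<in> complex_vector.span tensor_relators"
    by (simp add: algebra_simps)
qed

lift_definition scaleC_tensor :: "complex \<Rightarrow> ('a, 'b) tensor \<Rightarrow> ('a, 'b) tensor" is scaleC
  unfolding tensor_rel_def
  by (metis complex_vector.scale_right_diff_distrib complex_vector.span_scale)

instance
proof
  fix s t u :: "('a, 'b) tensor" and c d :: complex
  have rel: "tensor_rel p q" if "p = q" for p q :: "'a \<times> 'b \<Rightarrow>\<^sub>0 complex"
    using that by (simp add: tensor_rel_def complex_vector.span_zero)
  show "s + t + u = s + (t + u)" by transfer (rule rel, simp add: add.assoc)
  show "s + t = t + s" by transfer (rule rel, simp add: add.commute)
  show "0 + s = s" by transfer (rule rel, simp)
  show "- s + s = 0" by transfer (rule rel, simp)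
  show "s - t = s + - t" by transfer (rule rel, simp)
  show "c *\<^sub>C (s + t) = c *\<^sub>C s + c *\<^sub>C t" by transfer (rule rel, simp add: scaleC_add_right)
  show "(c + d) *\<^sub>C s = c *\<^sub>C s + d *\<^sub>C s" by transfer (rule rel, simp add: scaleC_add_left)
  show "c *\<^sub>C d *\<^sub>C s = (c * d) *\<^sub>C s" by transfer (rule rel, simp add: scaleC_scaleC)
  show "1 *\<^sub>C s = s" by transfer (rule rel, simp add: scaleC_one)
qed

end

lift_definition pure_tensor ::
  "'a::complex_vector \<Rightarrow> 'b::complex_vector \<Rightarrow> ('a, 'b) tensor" (infixr "\<otimes>" 70)
  is "\<lambda>x y. free_gen (x, y)" .

subsection \<open>Universal property\<close>

lemma cbilinear_pure_tensor: "cbilinear (\<otimes>)"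
proof -
  note base = complex_vector.span_base[of _ tensor_relators]
  have "x \<otimes> (y + y') = x \<otimes> y + x \<otimes> y'" for x :: 'a and y y' :: 'b
    by transfer (unfold tensor_rel_def diff_diff_eq[symmetric], rule base,
        unfold tensor_relators_def, blast)
  moreover have "(x + x') \<otimes> y = x \<otimes> y + x' \<otimes> y" for x x' :: 'a and y :: 'b
    by transfer (unfold tensor_rel_def diff_diff_eq[symmetric], rule base,
        unfold tensor_relators_def, blast)
  moreover have "(c *\<^sub>C x) \<otimes> y = c *\<^sub>C (x \<otimes> y)" for c and x :: 'a and y :: 'b
    by transfer (unfold tensor_rel_def, rule base, unfold tensor_relators_def, blast)
  moreover have "x \<otimes> (c *\<^sub>C y) = c *\<^sub>C (x \<otimes> y)" for c and x :: 'a and y :: 'b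
    by transfer (unfold tensor_rel_def, rule base, unfold tensor_relators_def, blast)
  ultimately show ?thesis
    by (simp add: cbilinear_def clinear_iff)
qed

lemma
  fixes x x' :: "'a::complex_vector" and y y' :: "'b::complex_vector"
  shows pure_tensor_add_left: "(x + x') \<otimes> y = x \<otimes> y + x' \<otimes> y"
    and pure_tensor_add_right: "x \<otimes> (y + y') = x \<otimes> y + x \<otimes> y'"
    and pure_tensor_scale_left: "(c *\<^sub>C x) \<otimes> y = c *\<^sub>C (x \<otimes> y)"
    and pure_tensor_scale_right: "x \<otimes> (c *\<^sub>C y) = c *\<^sub>C (x \<otimes> y)"
  using cbilinear_pure_tensor[where 'a = 'a and 'b = 'b] by (simp_all add: cbilinear_def clinear_iff)

lemmas pure_tensor_simps =
  pure_tensor_add_left pure_tensor_add_right pure_tensor_scale_left pure_tensor_scale_right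

lemma cbilinear_simps:
  assumes "cbilinear f"
  shows "f (x + x') y = f x y + f x' y" "f x (y + y') = f x y + f x y'"
    "f (c *\<^sub>C x) y = c *\<^sub>C f x y" "f x (c *\<^sub>C y) = c *\<^sub>C f x y"
  using assms by (simp_all add: cbilinear_def clinear_iff)

lemma cbilinear_tensor_prod:
  assumes "cbilinear f" "cbilinear g"
  shows "cbilinear (\<lambda>x1 x2. f x1 y1 \<otimes> g x2 y2)" "cbilinear (\<lambda>y1 y2. f x1 y1 \<otimes> g x2 y2)"
  by (simp_all add: cbilinear_def clinear_iff cbilinear_simps[OF assms(1)]
      cbilinear_simps[OF assms(2)] pure_tensor_simps)

lemma cbilinear_plus:
  assumes "cbilinear f" "cbilinear g"
  shows "cbilinear (\<lambda>x y. f x y + g x y)"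
  by (simp add: cbilinear_def clinear_iff cbilinear_simps[OF assms(1)]
      cbilinear_simps[OF assms(2)] scaleC_add_right add_ac)

lemma poly_mapping_span_free_gen: "p \<in> complex_vector.span (range free_gen)"
proof (induction p rule: update_induct)
  case const
  show ?case by (rule complex_vector.span_zero)
next
  case (update p k c)
  have "Poly_Mapping.update k c p = p + c *\<^sub>C free_gen k"
    using update(1)
    by (intro poly_mapping_eqI)
      (auto simp: lookup_update lookup_add scaleC_poly_mapping.rep_eq lookup_single
        scaleC_complex_def in_keys_iff when_def)
  then show ?case
    using update by (simp add: complex_vector.span_add complex_vector.span_scale
        complex_vector.span_base)
qed

lemma tensor_induct [case_names pure add scale]:
  assumes pure: "\<And>x y. P (x \<otimes> y)"
    and add: "\<And>s t. P s \<Longrightarrow> P t \<Longrightarrow> P (s + t)"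
    and scale: "\<And>c s. P s \<Longrightarrow> P (c *\<^sub>C s)"
  shows "P t"
proof -
  have "P (abs_tensor p)" for p
  proof (rule complex_vector.span_induct_alt[OF poly_mapping_span_free_gen[of p]])
    have "P (0 *\<^sub>C (0 \<otimes> 0))" using pure scale by blast
    then show "P (abs_tensor 0)"
      by (simp add: zero_tensor_def)
  next
    fix c and g q :: "'a \<times> 'b \<Rightarrow>\<^sub>0 complex"
    assume "g \<in> range free_gen" and q: "P (abs_tensor q)"
    then obtain x y where g: "g = free_gen (x, y)" by auto
    have "abs_tensor (c *\<^sub>C g + q) = c *\<^sub>C (x \<otimes> y) + abs_tensor q"
      by (simp add: g pure_tensor.abs_eq scaleC_tensor.abs_eq plus_tensor.abs_eq)
    then show "P (abs_tensor (c *\<^sub>C g + q))"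
      using pure add scale q by simp
  qed
  then show ?thesis by (rule tensor.abs_induct)
qed

lemma clinear_tensor_eqI:
  assumes "clinear h" "clinear h'" "\<And>x y. h (x \<otimes> y) = h' (x \<otimes> y)"
  shows "h = h'"
proof
  fix t
  show "h t = h' t"
    by (induction t rule: tensor_induct) (simp_all add: assms clinear_add clinear_scale)
qed

lemma free_lift_exists:
  fixes f :: "'k \<Rightarrow> 'c::complex_vector"
  shows "\<exists>H. clinear H \<and> (\<forall>k. H (free_gen k) = f k)"
proof -
  define H where "H p = (\<Sum>k\<in>Poly_Mapping.keys p. Poly_Mapping.lookup p k *\<^sub>C f k)" for p
  have H: "H p = (\<Sum>k\<in>A. Poly_Mapping.lookup p k *\<^sub>C f k)"
    if "finite A" "Poly_Mapping.keys p \<subseteq> A" for p A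
    unfolding H_def using that by (intro sum.mono_neutral_left) (auto simp: in_keys_iff)
  have add: "H (p + q) = H p + H q" for p q
  proof -
    let ?A = "Poly_Mapping.keys p \<union> Poly_Mapping.keys q"
    show ?thesis
      using keys_add[of p q]
      by (simp add: H[of ?A] lookup_add scaleC_add_left sum.distrib)
  qed
  have scale: "H (c *\<^sub>C p) = c *\<^sub>C H p" for c p
  proof -
    have "Poly_Mapping.keys (c *\<^sub>C p) \<subseteq> Poly_Mapping.keys p"
      by (auto simp: in_keys_iff scaleC_poly_mapping.rep_eq scaleC_complex_def)
    then show ?thesis
      by (simp add: H[of "Poly_Mapping.keys p"] scaleC_poly_mapping.rep_eq scaleC_complex_def
          scaleC_scaleC complex_vector.scale_sum_right)
  qed
  have "H (free_gen k) = f k" for k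
    by (simp add: H_def scaleC_one)
  with add scale show ?thesis
    by (auto simp: clinear_iff)
qed

theorem tensor_universal_property:
  fixes f :: "'a::complex_vector \<Rightarrow> 'b::complex_vector \<Rightarrow> 'c::complex_vector"
  assumes f: "cbilinear f"
  shows "\<exists>!h. clinear h \<and> (\<forall>x y. h (x \<otimes> y) = f x y)"
proof -
  obtain H :: "('a \<times> 'b \<Rightarrow>\<^sub>0 complex) \<Rightarrow> 'c"
    where H: "clinear H" and H_gen: "\<And>k. H (free_gen k) = case_prod f k"
    using free_lift_exists by metis
  have f': "f (x + x') y = f x y + f x' y" "f x (y + y') = f x y + f x y'"
    "f (c *\<^sub>C x) y = c *\<^sub>C f x y" "f x (c *\<^sub>C y) = c *\<^sub>C f x y" for x x' y y' c
    using f by (auto simp: cbilinear_def clinear_iff)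
  have gen0: "H r = 0" if "r \<in> tensor_relators" for r
    using that by (auto simp: tensor_relators_def clinear_diff[OF H] clinear_scale[OF H] H_gen f')
  have H0: "H r = 0" if "r \<in> complex_vector.span tensor_relators" for r
    using that
    by (induction rule: complex_vector.span_induct_alt)
      (simp_all add: gen0 clinear_0[OF H] clinear_add[OF H] clinear_scale[OF H])
  define h where "h t = H (rep_tensor t)" for t
  have h_abs: "h (abs_tensor p) = H p" for p
  proof -
    have "tensor_rel (rep_tensor (abs_tensor p)) p"
      using Quotient_rep_abs[OF Quotient_tensor] tensor_equivp by (metis equivp_reflp)
    then have "H (rep_tensor (abs_tensor p) - p) = 0"
      by (simp add: tensor_rel_def H0)
    then show ?thesis
      by (simp add: h_def clinear_diff[OF H])
  qed
  have add: "h (s + t) = h s + h t" for s t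
    by (induction s rule: tensor.abs_induct, induction t rule: tensor.abs_induct)
      (simp add: plus_tensor.abs_eq h_abs clinear_add[OF H])
  have scale: "h (c *\<^sub>C s) = c *\<^sub>C h s" for c s
    by (induction s rule: tensor.abs_induct) (simp add: scaleC_tensor.abs_eq h_abs clinear_scale[OF H])
  have "h (x \<otimes> y) = f x y" for x y
    by (simp add: pure_tensor.abs_eq h_abs H_gen)
  with add scale have h: "clinear h" "\<forall>x y. h (x \<otimes> y) = f x y"
    by (simp_all add: clinear_iff)
  show ?thesis
  proof (rule ex1I[of _ h])
    show "clinear h \<and> (\<forall>x y. h (x \<otimes> y) = f x y)"
      using h by blast
    show "h' = h" if "clinear h' \<and> (\<forall>x y. h' (x \<otimes> y) = f x y)" for h'
      using that h by (intro clinear_tensor_eqI) auto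
  qed
qed

subsection \<open>Bilinear operations given on pure tensors\<close>

text \<open>
  \<open>bilinear_extension F\<close> is the bilinear operation \<open>m\<close> on the tensor product with
  \<open>m (x1 \<otimes> x2) (y1 \<otimes> y2) = F x1 x2 y1 y2\<close>.  It exists and is unique for quadrilinear \<open>F\<close>;
  for other \<open>F\<close> the description may denote an arbitrary operation.
\<close>

definition bilinear_extension ::
  "('a::complex_vector \<Rightarrow> 'b::complex_vector \<Rightarrow> 'a \<Rightarrow> 'b \<Rightarrow> ('a, 'b) tensor)
    \<Rightarrow> ('a, 'b) tensor \<Rightarrow> ('a, 'b) tensor \<Rightarrow> ('a, 'b) tensor" where
  "bilinear_extension F =
    (THE m. cbilinear m \<and> (\<forall>x1 x2 y1 y2. m (x1 \<otimes> x2) (y1 \<otimes> y2) = F x1 x2 y1 y2))"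

lemma bilinear_extension_ex1:
  fixes F :: "'a::complex_vector \<Rightarrow> 'b::complex_vector \<Rightarrow> 'a \<Rightarrow> 'b \<Rightarrow> ('a, 'b) tensor"
  assumes left: "\<And>y1 y2. cbilinear (\<lambda>x1 x2. F x1 x2 y1 y2)"
    and right: "\<And>x1 x2. cbilinear (F x1 x2)"
  shows "\<exists>!m. cbilinear m \<and> (\<forall>x1 x2 y1 y2. m (x1 \<otimes> x2) (y1 \<otimes> y2) = F x1 x2 y1 y2)"
proof -
  have "\<exists>h. clinear h \<and> (\<forall>y1 y2. h (y1 \<otimes> y2) = F x1 x2 y1 y2)" for x1 x2
    using tensor_universal_property[OF right] by blast
  then obtain L where L: "\<And>x1 x2. clinear (L x1 x2)"
    and L_pure: "\<And>x1 x2 y1 y2. L x1 x2 (y1 \<otimes> y2) = F x1 x2 y1 y2"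
    by metis
  have F: "F (x1 + x1') x2 y1 y2 = F x1 x2 y1 y2 + F x1' x2 y1 y2"
    "F x1 (x2 + x2') y1 y2 = F x1 x2 y1 y2 + F x1 x2' y1 y2"
    "F (c *\<^sub>C x1) x2 y1 y2 = c *\<^sub>C F x1 x2 y1 y2"
    "F x1 (c *\<^sub>C x2) y1 y2 = c *\<^sub>C F x1 x2 y1 y2" for x1 x1' x2 x2' y1 y2 c
    using left by (auto simp: cbilinear_def clinear_iff)
  note lin = clinear_add[OF L] clinear_scale[OF L]
  have L_bil: "cbilinear (\<lambda>x1 x2. L x1 x2 v)" for v
  proof (induction v rule: tensor_induct)
    case (pure x y)
    then show ?case by (simp add: L_pure left)
  next
    case (add s t)
    then show ?case by (simp add: lin cbilinear_def clinear_iff algebra_simps scaleC_add_right)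
  next
    case (scale c s)
    then show ?case
      by (simp add: lin cbilinear_def clinear_iff scaleC_add_right scaleC_scaleC mult.commute)
  qed
  have "\<exists>h. clinear h \<and> (\<forall>x1 x2. h (x1 \<otimes> x2) = L x1 x2 v)" for v
    using tensor_universal_property[OF L_bil] by blast
  then obtain M where M: "\<And>v. clinear (M v)"
    and M_pure: "\<And>v x1 x2. M v (x1 \<otimes> x2) = L x1 x2 v"
    by metis
  have "M (v + w) u = M v u + M w u" for u v w
    by (induction u rule: tensor_induct)
      (simp_all add: M_pure lin clinear_add[OF M] clinear_scale[OF M] scaleC_add_right)
  moreover have "M (c *\<^sub>C v) u = c *\<^sub>C M v u" for c u v
    by (induction u rule: tensor_induct)
      (simp_all add: M_pure lin clinear_add[OF M] clinear_scale[OF M] scaleC_add_right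
        scaleC_scaleC mult.commute)
  ultimately have "cbilinear (\<lambda>u v. M v u)"
    using M by (simp add: cbilinear_def clinear_iff)
  moreover have "\<forall>x1 x2 y1 y2. M (y1 \<otimes> y2) (x1 \<otimes> x2) = F x1 x2 y1 y2"
    by (simp add: M_pure L_pure)
  ultimately have ex:
    "\<exists>m. cbilinear m \<and> (\<forall>x1 x2 y1 y2. m (x1 \<otimes> x2) (y1 \<otimes> y2) = F x1 x2 y1 y2)"
    by (intro exI[of _ "\<lambda>u v. M v u"]) simp
  have uniq: "m = m'"
    if m: "cbilinear m" "\<forall>x1 x2 y1 y2. m (x1 \<otimes> x2) (y1 \<otimes> y2) = F x1 x2 y1 y2"
      and m': "cbilinear m'" "\<forall>x1 x2 y1 y2. m' (x1 \<otimes> x2) (y1 \<otimes> y2) = F x1 x2 y1 y2" for m m'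
  proof
    fix u
    have "m (x1 \<otimes> x2) = m' (x1 \<otimes> x2)" for x1 x2
      using m m' by (intro clinear_tensor_eqI) (auto simp: cbilinear_def)
    then have "(\<lambda>u. m u v) = (\<lambda>u. m' u v)" for v
      using m m' by (intro clinear_tensor_eqI) (auto simp: cbilinear_def)
    then show "m u = m' u"
      by (auto simp: fun_eq_iff)
  qed
  from ex show ?thesis
    by (rule ex_ex1I) (use uniq in auto)
qed

lemma
  fixes F :: "'a::complex_vector \<Rightarrow> 'b::complex_vector \<Rightarrow> 'a \<Rightarrow> 'b \<Rightarrow> ('a, 'b) tensor"
  assumes "\<And>y1 y2. cbilinear (\<lambda>x1 x2. F x1 x2 y1 y2)" "\<And>x1 x2. cbilinear (F x1 x2)"
  shows cbilinear_bilinear_extension: "cbilinear (bilinear_extension F)"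
    and bilinear_extension_pure:
      "bilinear_extension F (x1 \<otimes> x2) (y1 \<otimes> y2) = F x1 x2 y1 y2"
  using theI'[OF bilinear_extension_ex1[OF assms]] by (simp_all add: bilinear_extension_def)

definition tensor_ast ::
  "('a::complex_vector \<Rightarrow> 'a \<Rightarrow> 'a) \<Rightarrow> ('b::complex_vector \<Rightarrow> 'b \<Rightarrow> 'b)
    \<Rightarrow> ('a, 'b) tensor \<Rightarrow> ('a, 'b) tensor \<Rightarrow> ('a, 'b) tensor" where
  "tensor_ast ast1 ast2 = bilinear_extension (\<lambda>x1 x2 y1 y2. ast1 x1 y1 \<otimes> ast2 x2 y2)"

definition tensor_dia ::
  "('a::complex_vector \<Rightarrow> 'a \<Rightarrow> 'a) \<Rightarrow> ('a \<Rightarrow> 'a \<Rightarrow> 'a)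
    \<Rightarrow> ('b::complex_vector \<Rightarrow> 'b \<Rightarrow> 'b) \<Rightarrow> ('b \<Rightarrow> 'b \<Rightarrow> 'b)
    \<Rightarrow> ('a, 'b) tensor \<Rightarrow> ('a, 'b) tensor \<Rightarrow> ('a, 'b) tensor" where
  "tensor_dia ast1 dia1 ast2 dia2 = bilinear_extension
    (\<lambda>x1 x2 y1 y2. dia1 x1 y1 \<otimes> ast2 x2 y2 + ast1 x1 y1 \<otimes> dia2 x2 y2)"

lemma
  assumes "cbilinear ast1" "cbilinear ast2"
  shows cbilinear_tensor_ast: "cbilinear (tensor_ast ast1 ast2)"
    and tensor_ast_pure:
      "tensor_ast ast1 ast2 (x1 \<otimes> x2) (y1 \<otimes> y2) = ast1 x1 y1 \<otimes> ast2 x2 y2"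
  unfolding tensor_ast_def
  by (rule cbilinear_bilinear_extension; intro cbilinear_tensor_prod assms)
    (subst bilinear_extension_pure; intro cbilinear_tensor_prod assms refl)

lemma
  assumes "cbilinear ast1" "cbilinear dia1" "cbilinear ast2" "cbilinear dia2"
  shows cbilinear_tensor_dia: "cbilinear (tensor_dia ast1 dia1 ast2 dia2)"
    and tensor_dia_pure:
      "tensor_dia ast1 dia1 ast2 dia2 (x1 \<otimes> x2) (y1 \<otimes> y2) =
        dia1 x1 y1 \<otimes> ast2 x2 y2 + ast1 x1 y1 \<otimes> dia2 x2 y2"
  unfolding tensor_dia_def
  by (rule cbilinear_bilinear_extension; intro cbilinear_plus cbilinear_tensor_prod assms)
    (subst bilinear_extension_pure; intro cbilinear_plus cbilinear_tensor_prod assms refl)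

section \<open>Classes of algebras\<close>

type_synonym 'a binop = "'a \<Rightarrow> 'a \<Rightarrow> 'a"

definition comm_assoc :: "'a::complex_vector binop \<Rightarrow> bool" where
  "comm_assoc ast \<longleftrightarrow> cbilinear ast \<and>
    (\<forall>a b. ast a b = ast b a) \<and>
    (\<forall>a b c. ast (ast a b) c = ast a (ast b c))"

definition anticomm_antiassoc :: "'a::complex_vector binop \<Rightarrow> bool" where
  "anticomm_antiassoc ast \<longleftrightarrow> cbilinear ast \<and>
    (\<forall>a b. ast a b = - ast b a) \<and>
    (\<forall>a b c. ast (ast a b) c = - ast a (ast b c))"

definition lie_bracket :: "'a::complex_vector binop \<Rightarrow> bool" where
  "lie_bracket br \<longleftrightarrow> cbilinear br \<and>
    (\<forall>a. br a a = 0) \<and>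
    (\<forall>a b c. br (br a b) c + br (br b c) a + br (br c a) b = 0)"

definition mock_lie :: "'a::complex_vector binop \<Rightarrow> bool" where
  "mock_lie br \<longleftrightarrow> cbilinear br \<and>
    (\<forall>a b. br a b = br b a) \<and>
    (\<forall>a b c. br (br a b) c + br (br b c) a + br (br c a) b = 0)"

definition novikov_poisson ::
  "complex \<Rightarrow> 'a::complex_vector binop \<Rightarrow> 'a binop \<Rightarrow> bool" where
  "novikov_poisson \<delta> ast circ \<longleftrightarrow> comm_assoc ast \<and> cbilinear circ \<and>
    (\<forall>a b c. circ (circ a b) c = circ (circ a c) b) \<and>
    (\<forall>a b c. \<delta> *\<^sub>C circ (circ a b) c - circ a (circ b c) =
             \<delta> *\<^sub>C circ (circ b a) c - circ b (circ a c)) \<and>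
    (\<forall>a b c. circ (ast a b) c = ast a (circ b c)) \<and>
    (\<forall>a b c. \<delta> *\<^sub>C ast (circ a b) c - circ a (ast b c) =
             \<delta> *\<^sub>C ast (circ b a) c - circ b (ast a c))"

definition mock_novikov_poisson ::
  "complex \<Rightarrow> 'a::complex_vector binop \<Rightarrow> 'a binop \<Rightarrow> bool" where
  "mock_novikov_poisson \<delta> ast circ \<longleftrightarrow> anticomm_antiassoc ast \<and> cbilinear circ \<and>
    (\<forall>a b c. circ (circ a b) c + circ (circ a c) b = 0) \<and>
    (\<forall>a b c. \<delta> *\<^sub>C circ (circ a b) c + \<delta> *\<^sub>C circ (circ b a) c
             + circ a (circ b c) + circ b (circ a c) = 0) \<and>
    (\<forall>a b c. circ (ast a b) c + ast a (circ b c) = 0) \<and>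
    (\<forall>a b c. \<delta> *\<^sub>C ast (circ a b) c + \<delta> *\<^sub>C ast (circ b a) c
             + circ a (ast b c) + circ b (ast a c) = 0)"

definition poisson :: "complex \<Rightarrow> 'a::complex_vector binop \<Rightarrow> 'a binop \<Rightarrow> bool" where
  "poisson \<delta> ast br \<longleftrightarrow> comm_assoc ast \<and> lie_bracket br \<and>
    (\<forall>a b c. br (ast a b) c = \<delta> *\<^sub>C (ast a (br b c) + ast (br a c) b))"

definition mock_poisson :: "complex \<Rightarrow> 'a::complex_vector binop \<Rightarrow> 'a binop \<Rightarrow> bool" where
  "mock_poisson \<delta> ast br \<longleftrightarrow> anticomm_antiassoc ast \<and> mock_lie br \<and>
    (\<forall>a b c. br (ast a b) c = - (\<delta> *\<^sub>C (ast a (br b c) + ast (br a c) b)))"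

definition transposed_poisson ::
  "complex \<Rightarrow> 'a::complex_vector binop \<Rightarrow> 'a binop \<Rightarrow> bool" where
  "transposed_poisson \<delta> ast br \<longleftrightarrow> comm_assoc ast \<and> lie_bracket br \<and>
    (\<forall>a b c. (2 * \<delta>) *\<^sub>C ast a (br b c) = br (ast a b) c + br b (ast a c))"

definition transposed_mock_poisson ::
  "complex \<Rightarrow> 'a::complex_vector binop \<Rightarrow> 'a binop \<Rightarrow> bool" where
  "transposed_mock_poisson \<delta> ast br \<longleftrightarrow> anticomm_antiassoc ast \<and> mock_lie br \<and>
    (\<forall>a b c. (- 2 * \<delta>) *\<^sub>C ast a (br b c) = br (ast a b) c + br b (ast a c))"

text \<open>
  The three pairs of classes.  They are indexed by a datatype because a pair of predicates that is
  bound as a variable could not be applied to three different carrier types.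
\<close>

datatype class_pair = Novikov_Poisson | Poisson | Transposed_Poisson

primrec X_algebra ::
  "class_pair \<Rightarrow> complex \<Rightarrow> 'a::complex_vector binop \<Rightarrow> 'a binop \<Rightarrow> bool" where
  "X_algebra Novikov_Poisson = novikov_poisson"
| "X_algebra Poisson = poisson"
| "X_algebra Transposed_Poisson = transposed_poisson"

primrec Y_algebra ::
  "class_pair \<Rightarrow> complex \<Rightarrow> 'a::complex_vector binop \<Rightarrow> 'a binop \<Rightarrow> bool" where
  "Y_algebra Novikov_Poisson = mock_novikov_poisson"
| "Y_algebra Poisson = mock_poisson"
| "Y_algebra Transposed_Poisson = transposed_mock_poisson"

end

theory Submission
  imports Defs
begin

text \<open>
  Both classes of a pair are members of one family indexed by a sign \<open>\<epsilon>\<close> with \<open>\<epsilon>\<^sup>2 = 1\<close>.  In this form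
  the signs of two factors multiply.  With \<open>L(a,b,c) = \<delta>(a \<circ> b) \<circ> c - \<epsilon> a \<circ> (b \<circ> c)\<close> and
  \<open>M(a,b,c) = \<delta>(a \<circ> b) * c - \<epsilon> a \<circ> (b * c)\<close>, the Novikov axioms say that \<open>L\<close> and \<open>M\<close> are
  \<open>\<epsilon>\<close>-symmetric in \<open>a, b\<close>, and on pure tensors \<open>L\<close> and \<open>M\<close> of the product split into sums of
  tensors of such \<open>\<epsilon>\<close>-symmetric expressions.  For the brackets, \<open>(a * b) * c\<close> is invariant under
  cyclic permutations for either sign, and the compatibility conditions can be written without \<open>\<epsilon>\<close> as
  \<open>{a * b, c} = \<delta>({b, c} * a - {c, a} * b)\<close> and \<open>2\<delta> {a, b} * c = {c * a, b} - {b * c, a}\<close>.  The mixed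
  terms in the Jacobi sum then cancel; in the transposed case this holds only after multiplication by
  \<open>2\<delta>\<close>, which is where \<open>\<delta> \<noteq> 0\<close> enters.
\<close>

section \<open>Multilinear maps on tensor products\<close>

lemma
  assumes "cbilinear f"
  shows cbilinear_diff_left: "f (x - x') y = f x y - f x' y"
    and cbilinear_diff_right: "f x (y - y') = f x y - f x y'"
    and cbilinear_zero_left: "f 0 y = 0"
    and cbilinear_zero_right: "f x 0 = 0"
  using assms clinear_diff[of "f x"] clinear_diff[of "\<lambda>x. f x y"]
    clinear_0[of "f x"] clinear_0[of "\<lambda>x. f x y"]
  by (simp_all add: cbilinear_def)

lemmas pure_tensor_linear_simps = pure_tensor_simps
  cbilinear_diff_left[OF cbilinear_pure_tensor] cbilinear_diff_right[OF cbilinear_pure_tensor]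
  cbilinear_zero_left[OF cbilinear_pure_tensor] cbilinear_zero_right[OF cbilinear_pure_tensor]

lemmas scaleC_simps =
  scaleC_add_right complex_vector.scale_right_diff_distrib scaleC_scaleC

lemma tensor_bilinear_eqI:
  assumes "cbilinear f" "cbilinear g"
    and "\<And>x1 x2 y1 y2. f (x1 \<otimes> x2) (y1 \<otimes> y2) = g (x1 \<otimes> x2) (y1 \<otimes> y2)"
  shows "f s t = g s t"
proof -
  have "f (x1 \<otimes> x2) = g (x1 \<otimes> x2)" for x1 x2
    using assms by (intro clinear_tensor_eqI) (auto simp: cbilinear_def)
  then have "(\<lambda>s. f s t) = (\<lambda>s. g s t)"
    using assms(1,2) by (intro clinear_tensor_eqI) (auto simp: cbilinear_def)
  then show ?thesis by (rule fun_cong)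
qed

text \<open>Taking the last two arguments together as a bilinear map lets
  \<open>tensor_bilinear_eqI\<close> be applied while the first argument is fixed.\<close>

definition ctrilinear ::
  "('a::complex_vector \<Rightarrow> 'b::complex_vector \<Rightarrow> 'c::complex_vector \<Rightarrow> 'd::complex_vector) \<Rightarrow> bool"
  where "ctrilinear f \<longleftrightarrow> (\<forall>x. cbilinear (f x)) \<and> (\<forall>y z. clinear (\<lambda>x. f x y z))"

text \<open>Pure tensors span, so an identity linear in each variable can be checked where the
  products are explicit. The three-variable axioms of the tensor product are all verified in this
  way.\<close>

lemma tensor_trilinear_eqI:
  assumes "ctrilinear f" "ctrilinear g"
    and "\<And>x1 x2 y1 y2 z1 z2.
      f (x1 \<otimes> x2) (y1 \<otimes> y2) (z1 \<otimes> z2) = g (x1 \<otimes> x2) (y1 \<otimes> y2) (z1 \<otimes> z2)"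
  shows "f s t u = g s t u"
proof -
  have "f (x1 \<otimes> x2) t u = g (x1 \<otimes> x2) t u" for x1 x2
    by (rule tensor_bilinear_eqI) (use assms in \<open>simp_all add: ctrilinear_def\<close>)
  then have "(\<lambda>s. f s t u) = (\<lambda>s. g s t u)"
    using assms(1,2) by (intro clinear_tensor_eqI) (auto simp: ctrilinear_def)
  then show ?thesis by (rule fun_cong)
qed

lemma
  assumes "cbilinear f"
  shows cbilinear_swap: "cbilinear (\<lambda>x y. f y x)"
    and cbilinear_scale: "cbilinear (\<lambda>x y. c *\<^sub>C f x y)"
  by (simp_all add: cbilinear_def clinear_iff cbilinear_simps[OF assms] scaleC_simps mult.commute)

lemma
  assumes f: "cbilinear f" and g: "cbilinear g"
  shows ctrilinear_comp_left: "ctrilinear (\<lambda>x y z. g (f x y) z)"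
    and ctrilinear_comp_right: "ctrilinear (\<lambda>x y z. g x (f y z))"
  by (simp_all add: ctrilinear_def cbilinear_def clinear_iff
      cbilinear_simps[OF f] cbilinear_simps[OF g])

lemma
  assumes "ctrilinear f"
  shows ctrilinear_swap_left: "ctrilinear (\<lambda>x y z. f y x z)"
    and ctrilinear_swap_right: "ctrilinear (\<lambda>x y z. f x z y)"
    and ctrilinear_scale: "ctrilinear (\<lambda>x y z. c *\<^sub>C f x y z)"
  using assms
  by (simp_all add: ctrilinear_def cbilinear_def clinear_iff scaleC_simps mult.commute)

lemma
  assumes "ctrilinear f"
  shows ctrilinear_rotate: "ctrilinear (\<lambda>x y z. f y z x)"
    and ctrilinear_rotate': "ctrilinear (\<lambda>x y z. f z x y)"
  using assms by (simp_all add: ctrilinear_def cbilinear_def)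

lemma
  assumes "ctrilinear f" "ctrilinear g"
  shows ctrilinear_add: "ctrilinear (\<lambda>x y z. f x y z + g x y z)"
    and ctrilinear_diff: "ctrilinear (\<lambda>x y z. f x y z - g x y z)"
  using assms
  by (simp_all add: ctrilinear_def cbilinear_def clinear_iff scaleC_simps algebra_simps)

lemma ctrilinear_zero: "ctrilinear (\<lambda>x y z. 0)"
  by (simp add: ctrilinear_def cbilinear_def clinear_iff)

section \<open>Signed families of algebras\<close>

text \<open>The sign is a complex scalar constrained only by its square, so a product of two signs
  is again admissible and acts by scaling.\<close>

locale signed_assoc =
  fixes \<epsilon> :: complex and ast :: "'a::complex_vector binop"
  assumes sign: "\<epsilon> * \<epsilon> = 1"
    and bilinear: "cbilinear ast"
    and comm: "ast a b = \<epsilon> *\<^sub>C ast b a"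
    and assoc: "ast (ast a b) c = \<epsilon> *\<^sub>C ast a (ast b c)"
begin

lemma assoc': "ast a (ast b c) = \<epsilon> *\<^sub>C ast (ast a b) c"
  by (simp add: assoc sign)

text \<open>Both sides equal \<open>\<epsilon> *\<^sub>C ast a (ast b c)\<close>: the left by
  commuting \<open>a\<close> to the front, the right by reassociating.\<close>

lemma rotate: "ast (ast b c) a = ast (ast a b) c"
  by (simp add: comm[of _ a] assoc)

lemma swap_left: "ast (ast a b) c = \<epsilon> *\<^sub>C ast (ast b a) c"
  by (simp add: comm[of a b] cbilinear_simps[OF bilinear])

text \<open>Rotate \<open>c\<close> to the front, then exchange it with \<open>a\<close>.\<close>

lemma swap_right: "ast (ast a b) c = \<epsilon> *\<^sub>C ast (ast a c) b"
  using swap_left[of c a b] by (simp add: rotate[of a b c])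

end

locale signed_lie =
  fixes \<epsilon> :: complex and br :: "'a::complex_vector binop"
  assumes br_bilinear: "cbilinear br"
    and br_comm: "br a b = - (\<epsilon> *\<^sub>C br b a)"
    and jacobi: "br (br a b) c + br (br b c) a + br (br c a) b = 0"

locale signed_poisson = signed_assoc \<epsilon> ast + signed_lie \<epsilon> br
  for \<epsilon> :: complex and ast br :: "'a::complex_vector binop" +
  fixes \<delta> :: complex
  assumes leibniz: "br (ast a b) c = \<delta> *\<^sub>C (ast (br b c) a - ast (br c a) b)"

locale signed_transposed_poisson = signed_assoc \<epsilon> ast + signed_lie \<epsilon> br
  for \<epsilon> :: complex and ast br :: "'a::complex_vector binop" +
  fixes \<delta> :: complex
  assumes transposed_leibniz: "(2 * \<delta>) *\<^sub>C ast (br a b) c = br (ast c a) b - br (ast b c) a"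

locale signed_novikov = signed_assoc \<epsilon> ast
  for \<epsilon> :: complex and ast :: "'a::complex_vector binop" +
  fixes circ :: "'a binop" and \<delta> :: complex
  assumes circ_bilinear: "cbilinear circ"
    and right_comm: "circ (circ a b) c = \<epsilon> *\<^sub>C circ (circ a c) b"
    and left_sym: "\<delta> *\<^sub>C circ (circ a b) c - \<epsilon> *\<^sub>C circ a (circ b c) =
      \<epsilon> *\<^sub>C (\<delta> *\<^sub>C circ (circ b a) c - \<epsilon> *\<^sub>C circ b (circ a c))"
    and ast_circ: "circ (ast a b) c = \<epsilon> *\<^sub>C ast a (circ b c)"
    and mixed_left_sym: "\<delta> *\<^sub>C ast (circ a b) c - \<epsilon> *\<^sub>C circ a (ast b c) =
      \<epsilon> *\<^sub>C (\<delta> *\<^sub>C ast (circ b a) c - \<epsilon> *\<^sub>C circ b (ast a c))"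
begin

lemma ast_circ': "ast a (circ b c) = \<epsilon> *\<^sub>C circ (ast a b) c"
  by (simp add: ast_circ sign)

lemma ast_circ_swap: "circ (ast a b) c = \<epsilon> *\<^sub>C circ (ast b a) c"
  by (simp add: comm[of a b] cbilinear_simps[OF circ_bilinear])

text \<open>Two commutations and one use of \<open>ast_circ'\<close> give three signs, which reduce
  to one. This brings mixed products to the common form \<open>circ (ast _ _) _\<close>.\<close>

lemma circ_ast: "ast (circ a b) c = \<epsilon> *\<^sub>C circ (ast a c) b"
  by (simp add: comm[of "circ a b"] ast_circ' ast_circ_swap[of c a] sign)

end

section \<open>Equivalence of the class axioms with their signed forms\<close>

lemma add_self_eq_0_iff:
  fixes x :: "'a::complex_vector"
  shows "x + x = 0 \<longleftrightarrow> x = 0"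
proof -
  have "x + x = 2 *\<^sub>C x"
    using scaleC_add_left[of 1 1 x] by (simp only: one_add_one scaleC_one)
  then show ?thesis by simp
qed

lemma comm_assoc_iff: "comm_assoc ast \<longleftrightarrow> signed_assoc 1 ast"
  by (simp add: comm_assoc_def signed_assoc_def scaleC_one)

lemma anticomm_antiassoc_iff: "anticomm_antiassoc ast \<longleftrightarrow> signed_assoc (-1) ast"
  by (simp add: anticomm_antiassoc_def signed_assoc_def scaleC_one)

lemma mock_lie_iff: "mock_lie br \<longleftrightarrow> signed_lie (-1) br"
  by (simp add: mock_lie_def signed_lie_def scaleC_one)

text \<open>Polarising \<open>br (a + b) (a + b) = 0\<close> gives antisymmetry; the converse
  divides by 2.\<close>

lemma lie_bracket_iff: "lie_bracket br \<longleftrightarrow> signed_lie 1 br"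
proof -
  have "(\<forall>a. br a a = 0) \<longleftrightarrow> (\<forall>a b. br a b = - br b a)" if br: "cbilinear br"
  proof (intro iffI allI)
    fix a b
    assume "\<forall>a. br a a = 0"
    then have "br (a + b) (a + b) = 0" "br a a = 0" "br b b = 0" by blast+
    then show "br a b = - br b a"
      by (simp add: cbilinear_simps[OF br] eq_neg_iff_add_eq_0 add.commute)
  next
    fix a
    assume "\<forall>a b. br a b = - br b a"
    then have "br a a = - br a a" by blast
    then have "br a a + br a a = 0" by (rule eq_neg_iff_add_eq_0[THEN iffD1])
    then show "br a a = 0" by (rule add_self_eq_0_iff[THEN iffD1])
  qed
  then show ?thesis
    by (auto simp: lie_bracket_def signed_lie_def scaleC_one)
qed

text \<open>The class definitions carry the coefficient \<epsilon>\<delta>. Commuting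
  \<open>a\<close> to the right and reversing \<open>br a c\<close> each contribute another
  \<epsilon>, so all signs square away.\<close>

lemma leibniz_sign_free:
  assumes "signed_assoc \<epsilon> ast" "signed_lie \<epsilon> br"
  shows "\<epsilon> *\<^sub>C (\<delta> *\<^sub>C (ast a (br b c) + ast (br a c) b)) = \<delta> *\<^sub>C (ast (br b c) a - ast (br c a) b)"
proof -
  interpret signed_assoc \<epsilon> ast by fact
  interpret signed_lie \<epsilon> br by fact
  \<comment> \<open>Negation in the first argument is obtained as a difference from 0.\<close>
  have "ast (br a c) b = - (\<epsilon> *\<^sub>C ast (br c a) b)"
    using cbilinear_diff_left[OF bilinear, of 0 _ b]
    by (simp add: br_comm[of a c] cbilinear_simps[OF bilinear] cbilinear_zero_left[OF bilinear])
  then have "\<epsilon> *\<^sub>C (ast a (br b c) + ast (br a c) b) = ast (br b c) a - ast (br c a) b"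
    by (simp add: comm[of a] scaleC_simps sign)
  then show ?thesis
    by (metis scaleC_scaleC mult.commute)
qed

text \<open>The coefficients 2\<delta> and -2\<delta> of the two classes are 2\<epsilon>\<delta>;
  moving \<open>a\<close> behind the bracket absorbs the \<epsilon>. In the last term the signs from
  \<open>br_comm\<close> and \<open>comm\<close> cancel, leaving only a minus.\<close>

lemma transposed_leibniz_iff:
  assumes "signed_assoc \<epsilon> ast" "signed_lie \<epsilon> br"
  shows "(2 * \<epsilon> * \<delta>) *\<^sub>C ast a (br b c) = br (ast a b) c + br b (ast a c) \<longleftrightarrow>
    (2 * \<delta>) *\<^sub>C ast (br b c) a = br (ast a b) c - br (ast c a) b"
proof -
  interpret signed_assoc \<epsilon> ast by fact
  interpret signed_lie \<epsilon> br by fact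
  have "(2 * \<epsilon> * \<delta>) *\<^sub>C ast a (br b c) = (2 * \<delta>) *\<^sub>C ast (br b c) a"
    using sign by (simp add: comm[of a] scaleC_scaleC mult.commute mult.left_commute)
  moreover have "br b (ast a c) = - br (ast c a) b"
    by (simp add: br_comm[of b] comm[of a c] cbilinear_simps[OF br_bilinear] sign)
  ultimately show ?thesis by simp
qed

lemma poisson_iff: "poisson \<delta> ast br \<longleftrightarrow> signed_poisson 1 ast br \<delta>"
  using leibniz_sign_free[of 1 ast br \<delta>]
  by (auto simp: poisson_def signed_poisson_def signed_poisson_axioms_def comm_assoc_iff
      lie_bracket_iff scaleC_one)

lemma mock_poisson_iff: "mock_poisson \<delta> ast br \<longleftrightarrow> signed_poisson (-1) ast br \<delta>"
  using leibniz_sign_free[of "-1" ast br \<delta>]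
  by (auto simp: mock_poisson_def signed_poisson_def signed_poisson_axioms_def
      anticomm_antiassoc_iff mock_lie_iff scaleC_one)

lemma transposed_poisson_iff:
  "transposed_poisson \<delta> ast br \<longleftrightarrow> signed_transposed_poisson 1 ast br \<delta>"
  using transposed_leibniz_iff[of 1 ast br \<delta>]
  unfolding transposed_poisson_def signed_transposed_poisson_def
    signed_transposed_poisson_axioms_def comm_assoc_iff lie_bracket_iff
  by simp blast

lemma transposed_mock_poisson_iff:
  "transposed_mock_poisson \<delta> ast br \<longleftrightarrow> signed_transposed_poisson (-1) ast br \<delta>"
  using transposed_leibniz_iff[of "-1" ast br \<delta>]
  unfolding transposed_mock_poisson_def signed_transposed_poisson_def
    signed_transposed_poisson_axioms_def anticomm_antiassoc_iff mock_lie_iff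
  by simp blast

lemma novikov_poisson_iff: "novikov_poisson \<delta> ast circ \<longleftrightarrow> signed_novikov 1 ast circ \<delta>"
  by (simp add: novikov_poisson_def signed_novikov_def signed_novikov_axioms_def comm_assoc_iff
      scaleC_one)

lemma mock_novikov_poisson_iff:
  "mock_novikov_poisson \<delta> ast circ \<longleftrightarrow> signed_novikov (-1) ast circ \<delta>"
proof -
  \<comment> \<open>The sums \<open>x + u\<close> and \<open>y + v\<close> stand for L or M at
    (a,b,c) and (b,a,c) with \<epsilon> = -1, so the four-term axiom says that this expression is
    antisymmetric.\<close>
  have "x + y + u + v = 0 \<longleftrightarrow> x + u = - y - v" for x y u v :: 'a
    using eq_iff_diff_eq_0[of "x + u" "- y - v"] by (simp add: algebra_simps)
  then show ?thesis
    by (simp add: mock_novikov_poisson_def signed_novikov_def signed_novikov_axioms_def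
        anticomm_antiassoc_iff scaleC_one eq_neg_iff_add_eq_0)
qed

definition signed_algebra ::
  "class_pair \<Rightarrow> complex \<Rightarrow> complex \<Rightarrow> 'a::complex_vector binop \<Rightarrow> 'a binop \<Rightarrow> bool" where
  "signed_algebra P \<epsilon> \<delta> ast dia = (case P of
     Novikov_Poisson \<Rightarrow> signed_novikov \<epsilon> ast dia \<delta>
   | Poisson \<Rightarrow> signed_poisson \<epsilon> ast dia \<delta>
   | Transposed_Poisson \<Rightarrow> signed_transposed_poisson \<epsilon> ast dia \<delta>)"

lemma X_algebra_iff: "X_algebra P \<delta> ast dia \<longleftrightarrow> signed_algebra P 1 \<delta> ast dia"
  by (cases P)
    (simp_all add: signed_algebra_def novikov_poisson_iff poisson_iff transposed_poisson_iff)

lemma Y_algebra_iff: "Y_algebra P \<delta> ast dia \<longleftrightarrow> signed_algebra P (-1) \<delta> ast dia"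
  by (cases P)
    (simp_all add: signed_algebra_def mock_novikov_poisson_iff mock_poisson_iff
      transposed_mock_poisson_iff)

section \<open>Tensor products\<close>

text \<open>The composition rules cover the monomials (xy)z, x(yz), (yx)z, y(xz), (xz)y, (yz)x and
  (zx)y, the shapes that occur in the signed axioms.\<close>

lemmas ctrilinear_intros =
  ctrilinear_comp_left ctrilinear_comp_right
  ctrilinear_swap_left[OF ctrilinear_comp_left] ctrilinear_swap_left[OF ctrilinear_comp_right]
  ctrilinear_swap_right[OF ctrilinear_comp_left]
  ctrilinear_rotate[OF ctrilinear_comp_left] ctrilinear_rotate'[OF ctrilinear_comp_left]
  ctrilinear_add ctrilinear_diff ctrilinear_scale ctrilinear_zero

lemma signed_assoc_tensor:
  fixes ast1 :: "'a::complex_vector binop" and ast2 :: "'b::complex_vector binop"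
  assumes "signed_assoc \<epsilon>1 ast1" "signed_assoc \<epsilon>2 ast2"
  shows "signed_assoc (\<epsilon>1 * \<epsilon>2) (tensor_ast ast1 ast2)"
proof -
  interpret A1: signed_assoc \<epsilon>1 ast1 by fact
  interpret A2: signed_assoc \<epsilon>2 ast2 by fact
  let ?m = "tensor_ast ast1 ast2"
  note m = cbilinear_tensor_ast[OF A1.bilinear A2.bilinear]
  note m_pure = tensor_ast_pure[OF A1.bilinear A2.bilinear]
  show ?thesis
  proof
    show "\<epsilon>1 * \<epsilon>2 * (\<epsilon>1 * \<epsilon>2) = 1"
      using A1.sign A2.sign by (simp add: mult.left_commute mult.assoc)
    show "cbilinear ?m" by (rule m)
    show "?m s t = (\<epsilon>1 * \<epsilon>2) *\<^sub>C ?m t s" for s t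
    proof (rule tensor_bilinear_eqI[OF m cbilinear_scale[OF cbilinear_swap[OF m]]])
      fix x1 y1 :: 'a and x2 y2 :: 'b
      show "?m (x1 \<otimes> x2) (y1 \<otimes> y2) = (\<epsilon>1 * \<epsilon>2) *\<^sub>C ?m (y1 \<otimes> y2) (x1 \<otimes> x2)"
        by (simp add: m_pure A1.comm[of x1] A2.comm[of x2] pure_tensor_simps scaleC_scaleC mult_ac)
    qed
    show "?m (?m s t) u = (\<epsilon>1 * \<epsilon>2) *\<^sub>C ?m s (?m t u)" for s t u
      by (rule tensor_trilinear_eqI[where f = "\<lambda>s t u. ?m (?m s t) u"
            and g = "\<lambda>s t u. (\<epsilon>1 * \<epsilon>2) *\<^sub>C ?m s (?m t u)"];
          (intro ctrilinear_intros m)?)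
        (simp add: m_pure A1.assoc A2.assoc pure_tensor_simps scaleC_scaleC mult_ac)
  qed
qed

text \<open>
  The hypothesis \<open>mixed\<close> is what remains of the Jacobi identity on pure tensors, by
  \<open>signed_assoc.rotate\<close>.
\<close>

lemma signed_lie_tensor:
  fixes ast1 br1 :: "'a::complex_vector binop" and ast2 br2 :: "'b::complex_vector binop"
  assumes "signed_assoc \<epsilon>1 ast1" "signed_lie \<epsilon>1 br1"
    and "signed_assoc \<epsilon>2 ast2" "signed_lie \<epsilon>2 br2"
    and mixed: "\<And>x1 x2 y1 y2 z1 z2.
      ast1 (br1 x1 y1) z1 \<otimes> br2 (ast2 x2 y2) z2 + br1 (ast1 x1 y1) z1 \<otimes> ast2 (br2 x2 y2) z2 +
      (ast1 (br1 y1 z1) x1 \<otimes> br2 (ast2 y2 z2) x2 + br1 (ast1 y1 z1) x1 \<otimes> ast2 (br2 y2 z2) x2) +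
      (ast1 (br1 z1 x1) y1 \<otimes> br2 (ast2 z2 x2) y2 + br1 (ast1 z1 x1) y1 \<otimes> ast2 (br2 z2 x2) y2) = 0"
  shows "signed_lie (\<epsilon>1 * \<epsilon>2) (tensor_dia ast1 br1 ast2 br2)"
proof -
  interpret A1: signed_assoc \<epsilon>1 ast1 by fact
  interpret A2: signed_assoc \<epsilon>2 ast2 by fact
  interpret L1: signed_lie \<epsilon>1 br1 by fact
  interpret L2: signed_lie \<epsilon>2 br2 by fact
  let ?d = "tensor_dia ast1 br1 ast2 br2"
  note bil = A1.bilinear L1.br_bilinear A2.bilinear L2.br_bilinear
  note d = cbilinear_tensor_dia[OF bil]
  note d_pure = tensor_dia_pure[OF bil]
  have neg: "u \<otimes> - v = - (u \<otimes> v)" "- u \<otimes> v = - (u \<otimes> v)" for u :: 'a and v :: 'b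
    using pure_tensor_linear_simps(6)[of u 0 v] pure_tensor_linear_simps(5)[of 0 u v]
    by (simp_all add: pure_tensor_linear_simps)
  show ?thesis
  proof
    show "cbilinear ?d" by (rule d)
    show "?d s t = - ((\<epsilon>1 * \<epsilon>2) *\<^sub>C ?d t s)" for s t
    proof -
      \<comment> \<open>Each summand contains one bracket and one product, so both acquire the same
        sign. As a scalar factor it makes the right-hand side a scaled swap of
        \<open>?d\<close>.\<close>
      have "?d s t = (- (\<epsilon>1 * \<epsilon>2)) *\<^sub>C ?d t s"
      proof (rule tensor_bilinear_eqI[OF d cbilinear_scale[OF cbilinear_swap[OF d]]])
        fix x1 y1 :: 'a and x2 y2 :: 'b
        show "?d (x1 \<otimes> x2) (y1 \<otimes> y2) = (- (\<epsilon>1 * \<epsilon>2)) *\<^sub>C ?d (y1 \<otimes> y2) (x1 \<otimes> x2)"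
          by (simp add: d_pure A1.comm[of x1] A2.comm[of x2] L1.br_comm[of x1] L2.br_comm[of x2]
              pure_tensor_simps scaleC_simps neg mult_ac)
      qed
      then show ?thesis by simp
    qed
    show "?d (?d s t) u + ?d (?d t u) s + ?d (?d u s) t = 0" for s t u
    proof (rule tensor_trilinear_eqI[
          where f = "\<lambda>s t u. ?d (?d s t) u + ?d (?d t u) s + ?d (?d u s) t"
            and g = "\<lambda>s t u. 0"])
      show "ctrilinear (\<lambda>s t u. ?d (?d s t) u + ?d (?d t u) s + ?d (?d u s) t)"
        by (intro ctrilinear_intros d)
      show "ctrilinear (\<lambda>(s :: ('a, 'b) tensor) (t :: ('a, 'b) tensor) (u :: ('a, 'b) tensor).
          0 :: ('a, 'b) tensor)"
        by (rule ctrilinear_zero)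
      fix x1 y1 z1 :: 'a and x2 y2 z2 :: 'b
      let ?p1 = "ast1 (ast1 x1 y1) z1" and ?p2 = "ast2 (ast2 x2 y2) z2"
      \<comment> \<open>The last group collects the terms with one bracket in each factor, which are
        those of \<open>mixed\<close>.\<close>
      have expand: "?d (?d (u1 \<otimes> u2) (v1 \<otimes> v2)) (w1 \<otimes> w2) =
          br1 (br1 u1 v1) w1 \<otimes> ast2 (ast2 u2 v2) w2 + ast1 (ast1 u1 v1) w1 \<otimes> br2 (br2 u2 v2) w2 +
          (ast1 (br1 u1 v1) w1 \<otimes> br2 (ast2 u2 v2) w2 + br1 (ast1 u1 v1) w1 \<otimes> ast2 (br2 u2 v2) w2)"
        for u1 v1 w1 u2 v2 w2
        by (simp add: d_pure cbilinear_simps[OF d])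
      \<comment> \<open>Rotation makes a triple product the common factor of three cyclic terms, so
        the Jacobi identity of the other algebra applies.\<close>
      have rot: "ast1 (ast1 y1 z1) x1 = ?p1" "ast1 (ast1 z1 x1) y1 = ?p1"
        "ast2 (ast2 y2 z2) x2 = ?p2" "ast2 (ast2 z2 x2) y2 = ?p2"
        by (rule A1.rotate A2.rotate A1.rotate[symmetric] A2.rotate[symmetric])+
      have "br1 (br1 x1 y1) z1 \<otimes> ?p2 + br1 (br1 y1 z1) x1 \<otimes> ?p2 + br1 (br1 z1 x1) y1 \<otimes> ?p2 = 0"
        by (simp only: pure_tensor_add_left[symmetric] L1.jacobi cbilinear_zero_left[OF cbilinear_pure_tensor])
      moreover have "?p1 \<otimes> br2 (br2 x2 y2) z2 + ?p1 \<otimes> br2 (br2 y2 z2) x2 + ?p1 \<otimes> br2 (br2 z2 x2) y2 = 0"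
        by (simp only: pure_tensor_add_right[symmetric] L2.jacobi cbilinear_zero_right[OF cbilinear_pure_tensor])
      moreover note mixed[of x1 y1 z1 x2 y2 z2]
      moreover have "(j1 + k1 + m1) + (j2 + k2 + m2) + (j3 + k3 + m3) =
          (j1 + j2 + j3) + (k1 + k2 + k3) + (m1 + m2 + m3)"
        for j1 j2 j3 k1 k2 k3 m1 m2 m3 :: "('a, 'b) tensor"
        by (simp add: add_ac)
      ultimately show "?d (?d (x1 \<otimes> x2) (y1 \<otimes> y2)) (z1 \<otimes> z2) + ?d (?d (y1 \<otimes> y2) (z1 \<otimes> z2)) (x1 \<otimes> x2) +
          ?d (?d (z1 \<otimes> z2) (x1 \<otimes> x2)) (y1 \<otimes> y2) = 0"
        by (simp only: expand rot add_0_left)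
    qed
  qed
qed

section \<open>Poisson structures\<close>

lemma signed_poisson_tensor:
  fixes ast1 br1 :: "'a::complex_vector binop" and ast2 br2 :: "'b::complex_vector binop"
  assumes "signed_poisson \<epsilon>1 ast1 br1 \<delta>" "signed_poisson \<epsilon>2 ast2 br2 \<delta>"
  shows "signed_poisson (\<epsilon>1 * \<epsilon>2) (tensor_ast ast1 ast2) (tensor_dia ast1 br1 ast2 br2) \<delta>"
proof -
  interpret A1: signed_poisson \<epsilon>1 ast1 br1 \<delta> by fact
  interpret A2: signed_poisson \<epsilon>2 ast2 br2 \<delta> by fact
  let ?m = "tensor_ast ast1 ast2" and ?d = "tensor_dia ast1 br1 ast2 br2"
  note bil = A1.bilinear A1.br_bilinear A2.bilinear A2.br_bilinear
  note m = cbilinear_tensor_ast[OF bil(1,3)] and d = cbilinear_tensor_dia[OF bil]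
  note pure = tensor_ast_pure[OF bil(1,3)] tensor_dia_pure[OF bil]
  \<comment> \<open>Let a1, a2, a3 be \<open>ast1 (br1 x1 y1) z1\<close> and its cyclic shifts, and
    b1, b2, b3 their analogues in the second factor. By the Leibniz rule the mixed sum is \<delta>
    times a1 \<otimes> (b2 - b3) + (a2 - a3) \<otimes> b1 plus its cyclic shifts, which cancels in
    pairs.\<close>
  have lie: "signed_lie (\<epsilon>1 * \<epsilon>2) ?d"
    by (rule signed_lie_tensor[OF A1.signed_assoc_axioms A1.signed_lie_axioms
            A2.signed_assoc_axioms A2.signed_lie_axioms])
      (simp add: A1.leibniz A2.leibniz pure_tensor_linear_simps scaleC_simps)
  have leibniz: "?d (?m s t) u = \<delta> *\<^sub>C (?m (?d t u) s - ?m (?d u s) t)" for s t u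
  proof (rule tensor_trilinear_eqI[where f = "\<lambda>s t u. ?d (?m s t) u"
        and g = "\<lambda>s t u. \<delta> *\<^sub>C (?m (?d t u) s - ?m (?d u s) t)"])
    show "ctrilinear (\<lambda>s t u. ?d (?m s t) u)"
      "ctrilinear (\<lambda>s t u. \<delta> *\<^sub>C (?m (?d t u) s - ?m (?d u s) t))"
      by (intro ctrilinear_intros m d)+
    fix x1 y1 z1 :: 'a and x2 y2 z2 :: 'b
    \<comment> \<open>Each summand is the Leibniz rule of one factor tensored with a triple product
      of the other; rotation identifies the three triple products.\<close>
    show "?d (?m (x1 \<otimes> x2) (y1 \<otimes> y2)) (z1 \<otimes> z2) =
      \<delta> *\<^sub>C (?m (?d (y1 \<otimes> y2) (z1 \<otimes> z2)) (x1 \<otimes> x2) - ?m (?d (z1 \<otimes> z2) (x1 \<otimes> x2)) (y1 \<otimes> y2))"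
      by (simp add: pure cbilinear_simps[OF m] A1.leibniz A2.leibniz pure_tensor_linear_simps
          scaleC_simps A1.rotate[of y1 z1 x1] A2.rotate[of y2 z2 x2]
          A1.rotate[of x1 y1 z1, symmetric] A2.rotate[of x2 y2 z2, symmetric])
  qed
  show ?thesis
    using signed_assoc_tensor[OF A1.signed_assoc_axioms A2.signed_assoc_axioms] lie leibniz
    by (simp add: signed_poisson_def signed_poisson_axioms_def)
qed

section \<open>Transposed Poisson structures\<close>

lemma signed_transposed_poisson_tensor:
  fixes ast1 br1 :: "'a::complex_vector binop" and ast2 br2 :: "'b::complex_vector binop"
  assumes "\<delta> \<noteq> 0"
    and "signed_transposed_poisson \<epsilon>1 ast1 br1 \<delta>" "signed_transposed_poisson \<epsilon>2 ast2 br2 \<delta>"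
  shows "signed_transposed_poisson (\<epsilon>1 * \<epsilon>2) (tensor_ast ast1 ast2) (tensor_dia ast1 br1 ast2 br2) \<delta>"
proof -
  interpret A1: signed_transposed_poisson \<epsilon>1 ast1 br1 \<delta> by fact
  interpret A2: signed_transposed_poisson \<epsilon>2 ast2 br2 \<delta> by fact
  let ?m = "tensor_ast ast1 ast2" and ?d = "tensor_dia ast1 br1 ast2 br2"
  note bil = A1.bilinear A1.br_bilinear A2.bilinear A2.br_bilinear
  note m = cbilinear_tensor_ast[OF bil(1,3)] and d = cbilinear_tensor_dia[OF bil]
  note pure = tensor_ast_pure[OF bil(1,3)] tensor_dia_pure[OF bil]
  \<comment> \<open>The scalar is moved to the side of the tensor that multiplies a bracket, where
    the compatibility condition can absorb it.\<close>
  have scale: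
    "(2 * \<delta>) *\<^sub>C (ast1 (br1 a b) c \<otimes> v) = (br1 (ast1 c a) b - br1 (ast1 b c) a) \<otimes> v"
    "(2 * \<delta>) *\<^sub>C (u \<otimes> ast2 (br2 a' b') c') = u \<otimes> (br2 (ast2 c' a') b' - br2 (ast2 b' c') a')"
    for a b c u a' b' c' v
    by (simp only: pure_tensor_scale_left[symmetric] A1.transposed_leibniz)
      (simp only: pure_tensor_scale_right[symmetric] A2.transposed_leibniz)
  have lie: "signed_lie (\<epsilon>1 * \<epsilon>2) ?d"
  proof (rule signed_lie_tensor[OF A1.signed_assoc_axioms A1.signed_lie_axioms
        A2.signed_assoc_axioms A2.signed_lie_axioms])
    fix x1 y1 z1 :: 'a and x2 y2 z2 :: 'b
    let ?mixed =
      "ast1 (br1 x1 y1) z1 \<otimes> br2 (ast2 x2 y2) z2 + br1 (ast1 x1 y1) z1 \<otimes> ast2 (br2 x2 y2) z2 +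
      (ast1 (br1 y1 z1) x1 \<otimes> br2 (ast2 y2 z2) x2 + br1 (ast1 y1 z1) x1 \<otimes> ast2 (br2 y2 z2) x2) +
      (ast1 (br1 z1 x1) y1 \<otimes> br2 (ast2 z2 x2) y2 + br1 (ast1 z1 x1) y1 \<otimes> ast2 (br2 z2 x2) y2)"
    \<comment> \<open>The substitution runs opposite to the Poisson case: with c1 =
      \<open>br1 (ast1 x1 y1) z1\<close> and cyclic shifts c2, c3, scaling
      \<open>ast1 (br1 x1 y1) z1\<close> gives c3 - c2. The same pairwise cancellation
      follows.\<close>
    have "(2 * \<delta>) *\<^sub>C ?mixed = 0"
      by (simp add: scaleC_add_right scale pure_tensor_linear_simps)
    then show "?mixed = 0"
      using \<open>\<delta> \<noteq> 0\<close> by (simp only: complex_vector.scale_eq_0_iff) simp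
  qed
  have leibniz: "(2 * \<delta>) *\<^sub>C ?m (?d s t) u = ?d (?m u s) t - ?d (?m t u) s" for s t u
  proof (rule tensor_trilinear_eqI[where f = "\<lambda>s t u. (2 * \<delta>) *\<^sub>C ?m (?d s t) u"
        and g = "\<lambda>s t u. ?d (?m u s) t - ?d (?m t u) s"])
    show "ctrilinear (\<lambda>s t u. (2 * \<delta>) *\<^sub>C ?m (?d s t) u)"
      "ctrilinear (\<lambda>s t u. ?d (?m u s) t - ?d (?m t u) s)"
      by (intro ctrilinear_intros m d)+
    fix x1 y1 z1 :: 'a and x2 y2 z2 :: 'b
    show "(2 * \<delta>) *\<^sub>C ?m (?d (x1 \<otimes> x2) (y1 \<otimes> y2)) (z1 \<otimes> z2) =
      ?d (?m (z1 \<otimes> z2) (x1 \<otimes> x2)) (y1 \<otimes> y2) - ?d (?m (y1 \<otimes> y2) (z1 \<otimes> z2)) (x1 \<otimes> x2)"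
      by (simp add: pure cbilinear_simps[OF m] scaleC_add_right scale pure_tensor_linear_simps
          A1.rotate[of y1 z1 x1] A2.rotate[of y2 z2 x2]
          A1.rotate[of x1 y1 z1, symmetric] A2.rotate[of x2 y2 z2, symmetric])
  qed
  show ?thesis
    using signed_assoc_tensor[OF A1.signed_assoc_axioms A2.signed_assoc_axioms] lie leibniz
    by (simp add: signed_transposed_poisson_def signed_transposed_poisson_axioms_def)
qed

section \<open>Novikov-Poisson structures\<close>

lemma signed_novikov_tensor:
  fixes ast1 circ1 :: "'a::complex_vector binop" and ast2 circ2 :: "'b::complex_vector binop"
  assumes "signed_novikov \<epsilon>1 ast1 circ1 \<delta>" "signed_novikov \<epsilon>2 ast2 circ2 \<delta>"
  shows "signed_novikov (\<epsilon>1 * \<epsilon>2) (tensor_ast ast1 ast2) (tensor_dia ast1 circ1 ast2 circ2) \<delta>"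
proof -
  interpret A1: signed_novikov \<epsilon>1 ast1 circ1 \<delta> by fact
  interpret A2: signed_novikov \<epsilon>2 ast2 circ2 \<delta> by fact
  let ?\<epsilon> = "\<epsilon>1 * \<epsilon>2"
  let ?m = "tensor_ast ast1 ast2" and ?d = "tensor_dia ast1 circ1 ast2 circ2"
  note bil = A1.bilinear A1.circ_bilinear A2.bilinear A2.circ_bilinear
  note m = cbilinear_tensor_ast[OF bil(1,3)] and d = cbilinear_tensor_dia[OF bil]
  note pure = tensor_ast_pure[OF bil(1,3)] tensor_dia_pure[OF bil]
    cbilinear_simps[OF m] cbilinear_simps[OF d]
  \<comment> \<open>Reordering scalars can leave a square inside a longer product; these rules
    remove it.\<close>
  have sign: "\<epsilon>1 * (\<epsilon>1 * c) = c" "\<epsilon>2 * (\<epsilon>2 * c) = c" for c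
    using A1.sign A2.sign by (simp_all add: mult.assoc[symmetric])
  note scalars = pure_tensor_linear_simps scaleC_simps mult_ac A1.sign A2.sign sign scaleC_one

  \<comment> \<open>Kept opaque, these expressions let \<epsilon>-symmetry act on a whole tensor
    factor at once.\<close>
  define L1 where "L1 x y z = \<delta> *\<^sub>C circ1 (circ1 x y) z - \<epsilon>1 *\<^sub>C circ1 x (circ1 y z)" for x y z
  define L2 where "L2 x y z = \<delta> *\<^sub>C circ2 (circ2 x y) z - \<epsilon>2 *\<^sub>C circ2 x (circ2 y z)" for x y z
  define M1 where "M1 x y z = \<delta> *\<^sub>C ast1 (circ1 x y) z - \<epsilon>1 *\<^sub>C circ1 x (ast1 y z)" for x y z
  define M2 where "M2 x y z = \<delta> *\<^sub>C ast2 (circ2 x y) z - \<epsilon>2 *\<^sub>C circ2 x (ast2 y z)" for x y z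
  have L1: "L1 x y z = \<epsilon>1 *\<^sub>C L1 y x z" for x y z
    unfolding L1_def by (rule A1.left_sym)
  have L2: "L2 x y z = \<epsilon>2 *\<^sub>C L2 y x z" for x y z
    unfolding L2_def by (rule A2.left_sym)
  have M1: "M1 x y z = \<epsilon>1 *\<^sub>C M1 y x z" for x y z
    unfolding M1_def by (rule A1.mixed_left_sym)
  have M2: "M2 x y z = \<epsilon>2 *\<^sub>C M2 y x z" for x y z
    unfolding M2_def by (rule A2.mixed_left_sym)

  have right_comm: "?d (?d s t) u = ?\<epsilon> *\<^sub>C ?d (?d s u) t" for s t u
  proof (rule tensor_trilinear_eqI[where f = "\<lambda>s t u. ?d (?d s t) u"
        and g = "\<lambda>s t u. ?\<epsilon> *\<^sub>C ?d (?d s u) t"])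
    show "ctrilinear (\<lambda>s t u. ?d (?d s t) u)" "ctrilinear (\<lambda>s t u. ?\<epsilon> *\<^sub>C ?d (?d s u) t)"
      by (intro ctrilinear_intros d)+
    fix x1 y1 z1 :: 'a and x2 y2 z2 :: 'b
    \<comment> \<open>After \<open>circ_ast\<close>, exchanging y and z interchanges the two mixed
      terms up to the sign \<epsilon>1\<epsilon>2.\<close>
    show "?d (?d (x1 \<otimes> x2) (y1 \<otimes> y2)) (z1 \<otimes> z2) = ?\<epsilon> *\<^sub>C ?d (?d (x1 \<otimes> x2) (z1 \<otimes> z2)) (y1 \<otimes> y2)"
      by (simp add: pure A1.circ_ast A2.circ_ast A1.right_comm[of x1 y1] A2.right_comm[of x2 y2]
          A1.swap_right[of x1 y1] A2.swap_right[of x2 y2] scalars add_ac)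
  qed

  have left_sym: "\<delta> *\<^sub>C ?d (?d s t) u - ?\<epsilon> *\<^sub>C ?d s (?d t u) =
      ?\<epsilon> *\<^sub>C (\<delta> *\<^sub>C ?d (?d t s) u - ?\<epsilon> *\<^sub>C ?d t (?d s u))" for s t u
  proof (rule tensor_trilinear_eqI[
        where f = "\<lambda>s t u. \<delta> *\<^sub>C ?d (?d s t) u - ?\<epsilon> *\<^sub>C ?d s (?d t u)"
        and g = "\<lambda>s t u. ?\<epsilon> *\<^sub>C (\<delta> *\<^sub>C ?d (?d t s) u - ?\<epsilon> *\<^sub>C ?d t (?d s u))"])
    show "ctrilinear (\<lambda>s t u. \<delta> *\<^sub>C ?d (?d s t) u - ?\<epsilon> *\<^sub>C ?d s (?d t u))"
      "ctrilinear (\<lambda>s t u. ?\<epsilon> *\<^sub>C (\<delta> *\<^sub>C ?d (?d t s) u - ?\<epsilon> *\<^sub>C ?d t (?d s u)))"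
      by (intro ctrilinear_intros d)+
    fix x1 y1 z1 :: 'a and x2 y2 z2 :: 'b
    \<comment> \<open>The rules \<open>assoc'\<close> and \<open>ast_circ'\<close> move all brackets
      to the left, so \<delta>-terms and sign-terms share a tensor factor and combine into L or M.
      Every factor on the right is symmetric in a and b up to its own sign.\<close>
    have expand: "\<delta> *\<^sub>C ?d (?d (a1 \<otimes> a2) (b1 \<otimes> b2)) (c1 \<otimes> c2) -
        ?\<epsilon> *\<^sub>C ?d (a1 \<otimes> a2) (?d (b1 \<otimes> b2) (c1 \<otimes> c2)) =
        L1 a1 b1 c1 \<otimes> ast2 (ast2 a2 b2) c2 + ast1 (ast1 a1 b1) c1 \<otimes> L2 a2 b2 c2 +
        M1 a1 b1 c1 \<otimes> circ2 (ast2 a2 b2) c2 + circ1 (ast1 a1 b1) c1 \<otimes> M2 a2 b2 c2"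
      for a1 b1 c1 a2 b2 c2
      unfolding L1_def L2_def M1_def M2_def
      by (simp add: pure A1.assoc' A2.assoc' A1.ast_circ' A2.ast_circ' scalars)
    show "\<delta> *\<^sub>C ?d (?d (x1 \<otimes> x2) (y1 \<otimes> y2)) (z1 \<otimes> z2) -
        ?\<epsilon> *\<^sub>C ?d (x1 \<otimes> x2) (?d (y1 \<otimes> y2) (z1 \<otimes> z2)) =
        ?\<epsilon> *\<^sub>C (\<delta> *\<^sub>C ?d (?d (y1 \<otimes> y2) (x1 \<otimes> x2)) (z1 \<otimes> z2) -
          ?\<epsilon> *\<^sub>C ?d (y1 \<otimes> y2) (?d (x1 \<otimes> x2) (z1 \<otimes> z2)))"
      unfolding expand
      by (simp add: L1[of x1] L2[of x2] M1[of x1] M2[of x2] A1.swap_left[of x1] A2.swap_left[of x2]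
          A1.ast_circ_swap[of x1] A2.ast_circ_swap[of x2] scalars)
  qed

  have ast_circ: "?d (?m s t) u = ?\<epsilon> *\<^sub>C ?m s (?d t u)" for s t u
  proof (rule tensor_trilinear_eqI[where f = "\<lambda>s t u. ?d (?m s t) u"
        and g = "\<lambda>s t u. ?\<epsilon> *\<^sub>C ?m s (?d t u)"])
    show "ctrilinear (\<lambda>s t u. ?d (?m s t) u)" "ctrilinear (\<lambda>s t u. ?\<epsilon> *\<^sub>C ?m s (?d t u))"
      by (intro ctrilinear_intros m d)+
    fix x1 y1 z1 :: 'a and x2 y2 z2 :: 'b
    show "?d (?m (x1 \<otimes> x2) (y1 \<otimes> y2)) (z1 \<otimes> z2) = ?\<epsilon> *\<^sub>C ?m (x1 \<otimes> x2) (?d (y1 \<otimes> y2) (z1 \<otimes> z2))"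
      by (simp add: pure A1.assoc A2.assoc A1.ast_circ A2.ast_circ scalars)
  qed

  have mixed_left_sym: "\<delta> *\<^sub>C ?m (?d s t) u - ?\<epsilon> *\<^sub>C ?d s (?m t u) =
      ?\<epsilon> *\<^sub>C (\<delta> *\<^sub>C ?m (?d t s) u - ?\<epsilon> *\<^sub>C ?d t (?m s u))" for s t u
  proof (rule tensor_trilinear_eqI[
        where f = "\<lambda>s t u. \<delta> *\<^sub>C ?m (?d s t) u - ?\<epsilon> *\<^sub>C ?d s (?m t u)"
        and g = "\<lambda>s t u. ?\<epsilon> *\<^sub>C (\<delta> *\<^sub>C ?m (?d t s) u - ?\<epsilon> *\<^sub>C ?d t (?m s u))"])
    show "ctrilinear (\<lambda>s t u. \<delta> *\<^sub>C ?m (?d s t) u - ?\<epsilon> *\<^sub>C ?d s (?m t u))"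
      "ctrilinear (\<lambda>s t u. ?\<epsilon> *\<^sub>C (\<delta> *\<^sub>C ?m (?d t s) u - ?\<epsilon> *\<^sub>C ?d t (?m s u)))"
      by (intro ctrilinear_intros m d)+
    fix x1 y1 z1 :: 'a and x2 y2 z2 :: 'b
    \<comment> \<open>Only M appears, because a single \<open>circ\<close> is distributed over the
      two factors.\<close>
    have expand: "\<delta> *\<^sub>C ?m (?d (a1 \<otimes> a2) (b1 \<otimes> b2)) (c1 \<otimes> c2) -
        ?\<epsilon> *\<^sub>C ?d (a1 \<otimes> a2) (?m (b1 \<otimes> b2) (c1 \<otimes> c2)) =
        M1 a1 b1 c1 \<otimes> ast2 (ast2 a2 b2) c2 + ast1 (ast1 a1 b1) c1 \<otimes> M2 a2 b2 c2"
      for a1 b1 c1 a2 b2 c2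
      unfolding M1_def M2_def by (simp add: pure A1.assoc' A2.assoc' scalars)
    show "\<delta> *\<^sub>C ?m (?d (x1 \<otimes> x2) (y1 \<otimes> y2)) (z1 \<otimes> z2) -
        ?\<epsilon> *\<^sub>C ?d (x1 \<otimes> x2) (?m (y1 \<otimes> y2) (z1 \<otimes> z2)) =
        ?\<epsilon> *\<^sub>C (\<delta> *\<^sub>C ?m (?d (y1 \<otimes> y2) (x1 \<otimes> x2)) (z1 \<otimes> z2) -
          ?\<epsilon> *\<^sub>C ?d (y1 \<otimes> y2) (?m (x1 \<otimes> x2) (z1 \<otimes> z2)))"
      unfolding expand
      by (simp add: M1[of x1] M2[of x2] A1.swap_left[of x1] A2.swap_left[of x2] scalars)
  qed

  show ?thesis
    using signed_assoc_tensor[OF A1.signed_assoc_axioms A2.signed_assoc_axioms] d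
      right_comm left_sym ast_circ mixed_left_sym
    unfolding signed_novikov_def signed_novikov_axioms_def by blast
qed

section \<open>Combination of the three pairs\<close>

lemma signed_algebra_tensor:
  assumes "\<delta> \<noteq> 0" "signed_algebra P \<epsilon>1 \<delta> ast1 dia1" "signed_algebra P \<epsilon>2 \<delta> ast2 dia2"
  shows "signed_algebra P (\<epsilon>1 * \<epsilon>2) \<delta> (tensor_ast ast1 ast2) (tensor_dia ast1 dia1 ast2 dia2)"
  using assms signed_novikov_tensor signed_poisson_tensor signed_transposed_poisson_tensor
  by (cases P) (auto simp: signed_algebra_def)

theorem theorem6p18:
  fixes \<delta> :: complex
    and P :: class_pair
    and \<epsilon>1 \<epsilon>2 :: int
    and ast1 dia1 :: "'a::complex_vector \<Rightarrow> 'a \<Rightarrow> 'a"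
    and ast2 dia2 :: "'b::complex_vector \<Rightarrow> 'b \<Rightarrow> 'b"
  assumes "\<delta> \<noteq> 0"
    and "(\<epsilon>1 = 1 \<and> X_algebra P \<delta> ast1 dia1) \<or> (\<epsilon>1 = -1 \<and> Y_algebra P \<delta> ast1 dia1)"
    and "(\<epsilon>2 = 1 \<and> X_algebra P \<delta> ast2 dia2) \<or> (\<epsilon>2 = -1 \<and> Y_algebra P \<delta> ast2 dia2)"
  shows "(\<epsilon>1 * \<epsilon>2 = 1 \<longrightarrow>
            X_algebra P \<delta> (tensor_ast ast1 ast2) (tensor_dia ast1 dia1 ast2 dia2)) \<and>
         (\<epsilon>1 * \<epsilon>2 = -1 \<longrightarrow>
            Y_algebra P \<delta> (tensor_ast ast1 ast2) (tensor_dia ast1 dia1 ast2 dia2))"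
proof -
  have "signed_algebra P (of_int \<epsilon>1) \<delta> ast1 dia1" "signed_algebra P (of_int \<epsilon>2) \<delta> ast2 dia2"
    using assms(2,3) by (auto simp: X_algebra_iff Y_algebra_iff)
  then have "signed_algebra P (of_int (\<epsilon>1 * \<epsilon>2)) \<delta>
      (tensor_ast ast1 ast2) (tensor_dia ast1 dia1 ast2 dia2)"
    using signed_algebra_tensor[OF assms(1)] by simp
  then show ?thesis
    \<comment> \<open>The product of signs stays inside \<open>of_int\<close>, so that the
      assumption on \<open>\<epsilon>1 * \<epsilon>2\<close> evaluates it to 1 or -1.\<close>
    by (auto simp: X_algebra_iff Y_algebra_iff simp del: of_int_mult)
qed

end
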